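(* Let $\mathcal M\subseteq\mathbb R^n$ be a Riemannian embedded submanifold, $f:\mathbb R^n\to\mathbb R$ continuously differentiable, $x_t\in\mathcal M$, $\gamma_t>0$, and let $h(x)=\frac14\|x\|^4+\frac12\|x\|^2$. Then the solution $$v_t=\arg\min_{v\in\mathcal T_{x_t}\mathcal M}\ \langle\nabla f(x_t),v\rangle+\gamma_tD_h(x_t+v,x_t)$$ admits the closed form $$v_t=-\theta_t\,\mathcal P_{\mathcal T_{x_t}\mathcal M}(c_t)-\mathcal P_{\mathcal T_{x_t}\mathcal M}(x_t),\qquad c_t=\frac{\nabla f(x_t)}{\gamma_t}-\nabla h(x_t),$$ where $\theta_t>0$ is the unique positive solution of $$\|\mathcal P_{\mathcal T_{x_t}\mathcal M}(c_t)\|^2\theta^3+\left(\|\mathcal P_{\mathcal N_{x_t}\mathcal M}(x_t)\|^2+1\right)\theta-1=0.$$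
   Context: $D_h(y,x)=h(y)-h(x)-\langle\nabla h(x),y-x\rangle$ is the Bregman distance. The tangent space $\mathcal T_x\mathcal M$ is viewed as a linear subspace of $\mathbb R^n$ with the Euclidean inner product, and $\mathcal N_x\mathcal M$ is its orthogonal complement; $\mathcal P_{\mathcal T_x\mathcal M}$ and $\mathcal P_{\mathcal N_x\mathcal M}$ are the orthogonal projections onto these subspaces. *)

theory Defs
  imports "HOL-Analysis.Analysis"
begin

text \<open>
  \<open>C\<^sup>k\<close> maps on an open set \<open>S\<close>, by recursion on directional derivatives. In finite dimension,
  continuity of all the maps \<open>x \<mapsto> Df(x) v\<close> amounts to continuity of \<open>x \<mapsto> Df(x)\<close> in operator norm.
\<close>

primrec Ck_on ::
    "nat \<Rightarrow> 'a::euclidean_space set \<Rightarrow> ('a \<Rightarrow> 'b::euclidean_space) \<Rightarrow> bool" where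
  "Ck_on 0 S f \<longleftrightarrow> continuous_on S f"
| "Ck_on (Suc k) S f \<longleftrightarrow>
     (\<forall>x\<in>S. f differentiable (at x)) \<and>
     (\<forall>v. Ck_on k S (\<lambda>x. frechet_derivative f (at x) v))"

definition smooth_on ::
    "'a::euclidean_space set \<Rightarrow> ('a \<Rightarrow> 'b::euclidean_space) \<Rightarrow> bool" where
  "smooth_on S f \<longleftrightarrow> (\<forall>k. Ck_on k S f)"

text \<open>
  Embedded submanifolds of a Euclidean space: subsets of some constant dimension \<open>d\<close> that are
  locally flattened onto a \<open>d\<close>-dimensional linear subspace by a diffeomorphism between open
  subsets of the ambient space. The Riemannian metric is always the one induced by the ambient
  inner product, so it is not carried as additional data.
\<close>

definition embedded_submanifold :: "'a::euclidean_space set \<Rightarrow> bool" where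
  "embedded_submanifold M \<longleftrightarrow>
     (\<exists>d. \<forall>x\<in>M. \<exists>U V \<phi> \<psi> L.
        open U \<and> x \<in> U \<and> open V \<and>
        homeomorphism U V \<phi> \<psi> \<and> smooth_on U \<phi> \<and> smooth_on V \<psi> \<and>
        subspace L \<and> dim L = d \<and> \<phi> ` (M \<inter> U) = V \<inter> (L :: 'a set))"

text \<open>Velocities at \<open>x\<close> of smooth curves that run inside \<open>M\<close>.\<close>

definition tangent_space_at :: "'a::euclidean_space set \<Rightarrow> 'a \<Rightarrow> 'a set" where
  "tangent_space_at M x =
     {v. \<exists>(\<epsilon>::real) c. \<epsilon> > 0 \<and> smooth_on {-\<epsilon><..<\<epsilon>} c \<and> c ` {-\<epsilon><..<\<epsilon>} \<subseteq> M \<and>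
           c 0 = x \<and> (c has_vector_derivative v) (at 0)}"

definition normal_space_at :: "'a::euclidean_space set \<Rightarrow> 'a \<Rightarrow> 'a set" where
  "normal_space_at M x = orthogonal_comp (tangent_space_at M x)"

text \<open>Only meaningful when \<open>W\<close> is a linear subspace.\<close>

definition orth_proj :: "'a::euclidean_space set \<Rightarrow> 'a \<Rightarrow> 'a" where
  "orth_proj W x = (THE y. y \<in> W \<and> x - y \<in> orthogonal_comp W)"

text \<open>Only meaningful where \<open>f\<close> is differentiable.\<close>

definition gradient :: "('a::euclidean_space \<Rightarrow> real) \<Rightarrow> 'a \<Rightarrow> 'a" where
  "gradient f x = (THE g. GDERIV f x :> g)"

definition continuously_differentiable :: "('a::euclidean_space \<Rightarrow> real) \<Rightarrow> bool" where
  "continuously_differentiable f \<longleftrightarrow>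
     (\<forall>x. f differentiable (at x)) \<and> continuous_on UNIV (gradient f)"

definition bregman :: "('a::euclidean_space \<Rightarrow> real) \<Rightarrow> 'a \<Rightarrow> 'a \<Rightarrow> real" where
  "bregman h y x = h y - h x - gradient h x \<bullet> (y - x)"

definition quartic_kernel :: "'a::euclidean_space \<Rightarrow> real" where
  "quartic_kernel x = 1/4 * norm x ^ 4 + 1/2 * norm x ^ 2"

end

theory Submission imports Defs begin

text \<open>
  A flattening diffeomorphism \<open>\<phi>\<close> with inverse \<open>\<psi>\<close> identifies the tangent space at \<open>x\<close> with the
  image of a linear subspace under \<open>D\<psi>(\<phi> x)\<close>, so it is a linear subspace \<open>T\<close>. Let \<open>n\<close> be the
  normal part of \<open>x\<close>, \<open>p\<close> the tangential part of \<open>c\<close> and \<open>u\<close> the tangential part of \<open>x + w\<close>. Up to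
  the factor \<open>\<gamma>\<close> and an additive constant the objective is
  \<open>p \<bullet> u + (\<parallel>n\<parallel>\<^sup>2 + \<parallel>u\<parallel>\<^sup>2)\<^sup>2 / 4 + (\<parallel>n\<parallel>\<^sup>2 + \<parallel>u\<parallel>\<^sup>2) / 2\<close>, whose excess over its value at the
  critical point \<open>u\<^sub>0 = - \<theta> p\<close> is exactly
  \<open>(\<parallel>n\<parallel>\<^sup>2 + \<parallel>u\<^sub>0\<parallel>\<^sup>2 + 1) \<parallel>u - u\<^sub>0\<parallel>\<^sup>2 / 2 + (\<parallel>u\<parallel>\<^sup>2 - \<parallel>u\<^sub>0\<parallel>\<^sup>2)\<^sup>2 / 4\<close>.
\<close>

section \<open>Calculus of \<open>Ck_on\<close> on open sets\<close>

lemma Ck_on_cong: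
  assumes "open S" "Ck_on k S f" "\<And>x. x \<in> S \<Longrightarrow> f x = g x"
  shows "Ck_on k S g"
  using assms(2,3)
proof (induction k arbitrary: f g)
  case 0
  then show ?case
    using continuous_on_cong[of S S f g] by simp
next
  case (Suc k)
  \<comment> \<open>Derivatives are taken in the full space, so agreement on \<open>S\<close> alone
    transfers them only because \<open>S\<close> is open.\<close>
  have D: "(g has_derivative frechet_derivative f (at x)) (at x)" if "x \<in> S" for x
  proof (rule has_derivative_transform_within_open[OF _ \<open>open S\<close> that])
    show "(f has_derivative frechet_derivative f (at x)) (at x)"
      using Suc.prems(1) that by (simp add: frechet_derivative_works[symmetric])
  qed (use Suc.prems(2) in simp)
  have "frechet_derivative f (at x) v = frechet_derivative g (at x) v" if "x \<in> S" for x v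
    using frechet_derivative_at[OF D[OF that]] by simp
  then have "Ck_on k S (\<lambda>x. frechet_derivative g (at x) v)" for v
    using Suc.IH[of "\<lambda>x. frechet_derivative f (at x) v"] Suc.prems(1) by simp
  then show ?case
    using D by (auto simp: differentiable_def)
qed

text \<open>For an affine inner map, the derivative in direction \<open>s\<close> is
  \<open>Df\<close> in the fixed direction \<open>B s\<close>, composed with the same affine map, so
  the induction closes without a product rule. It supplies the smooth curves
  \<open>t \<mapsto> \<psi> (\<phi> x + t *\<^sub>R l)\<close>.\<close>

lemma Ck_on_compose_affine:
  assumes "open S" "bounded_linear B" "\<And>t. t \<in> S \<Longrightarrow> a + B t \<in> V" "Ck_on k V f"
  shows "Ck_on k S (\<lambda>t. f (a + B t))"
  using assms(4)
proof (induction k arbitrary: f)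
  case 0
  then show ?case
    using assms(2,3)
    by (auto intro!: continuous_on_compose2[of V f] continuous_intros linear_continuous_on[of B])
next
  case (Suc k)
  have D: "((\<lambda>t. f (a + B t)) has_derivative
        (\<lambda>s. frechet_derivative f (at (a + B t)) (B s))) (at t)" if "t \<in> S" for t
  proof -
    have "(f has_derivative frechet_derivative f (at (a + B t))) (at (a + B t))"
      using Suc.prems assms(3)[OF that] by (simp add: frechet_derivative_works[symmetric])
    moreover have "((\<lambda>t. a + B t) has_derivative B) (at t)"
      using has_derivative_add[OF has_derivative_const bounded_linear_imp_has_derivative[OF assms(2)]]
      by simp
    ultimately show ?thesis
      using diff_chain_at[of "\<lambda>t. a + B t" B t f] by (simp add: o_def)
  qed
  have "Ck_on k S (\<lambda>t. frechet_derivative (\<lambda>t. f (a + B t)) (at t) s)" for s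
  proof (rule Ck_on_cong[OF \<open>open S\<close>])
    show "Ck_on k S (\<lambda>t. frechet_derivative f (at (a + B t)) (B s))"
      using Suc.IH[of "\<lambda>x. frechet_derivative f (at x) (B s)"] Suc.prems by simp
    show "frechet_derivative f (at (a + B t)) (B s) = frechet_derivative (\<lambda>t. f (a + B t)) (at t) s"
      if "t \<in> S" for t
      using frechet_derivative_at[OF D[OF that]] by metis
  qed
  then show ?case
    using D by (auto simp: differentiable_def)
qed

lemma smooth_on_has_derivative:
  assumes "smooth_on S f" "x \<in> S"
  shows "(f has_derivative frechet_derivative f (at x)) (at x)"
proof -
  have "Ck_on (Suc 0) S f"
    using assms(1) smooth_on_def by blast
  then show ?thesis
    using assms(2) by (simp add: frechet_derivative_works[symmetric])
qed

section \<open>Tangent spaces in a flattening chart\<close>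

lemma has_vector_derivative_in_closed_subspace:
  fixes c :: "real \<Rightarrow> 'a::euclidean_space"
  assumes "subspace L" "(c has_vector_derivative w) (at t0)" "\<forall>\<^sub>F t in at t0. c t \<in> L" "c t0 \<in> L"
  shows "w \<in> L"
proof (rule Lim_in_closed_set)
  show "closed L"
    using assms(1) by (rule closed_subspace)
  \<comment> \<open>Turns the remainder form of the derivative into convergence of difference
    quotients, which lie in the closed set \<open>L\<close>.\<close>
  have "norm ((c t - c t0) /\<^sub>R (t - t0) - w) = norm (c t - c t0 - (t - t0) *\<^sub>R w) / norm (t - t0)"
    if "t \<noteq> t0" for t
  proof -
    have "(c t - c t0) /\<^sub>R (t - t0) - w = (c t - c t0 - (t - t0) *\<^sub>R w) /\<^sub>R (t - t0)"
      using that by (simp add: scaleR_diff_right)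
    then show ?thesis
      by (simp only: norm_scaleR) (simp add: divide_inverse)
  qed
  then have "\<forall>\<^sub>F t in at t0. norm (c t - c t0 - (t - t0) *\<^sub>R w) / norm (t - t0)
      = norm ((c t - c t0) /\<^sub>R (t - t0) - w)"
    by (simp add: eventually_at_filter)
  moreover have "((\<lambda>t. norm (c t - c t0 - (t - t0) *\<^sub>R w) / norm (t - t0)) \<longlongrightarrow> 0) (at t0)"
    using assms(2) by (simp add: has_vector_derivative_def has_derivative_iff_norm)
  ultimately have "((\<lambda>t. norm ((c t - c t0) /\<^sub>R (t - t0) - w)) \<longlongrightarrow> 0) (at t0)"
    by (rule Lim_transform_eventually[rotated])
  then show "((\<lambda>t. (c t - c t0) /\<^sub>R (t - t0)) \<longlongrightarrow> w) (at t0)"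
    by (simp add: tendsto_norm_zero_iff Lim_null[of _ w])
  show "\<forall>\<^sub>F t in at t0. (c t - c t0) /\<^sub>R (t - t0) \<in> L"
    using assms(3) by eventually_elim (simp add: assms subspace_diff subspace_scale)
qed simp

text \<open>A curve in \<open>M\<close> is carried by \<phi> into \<open>L\<close>, so its velocity
  there lies in \<open>L\<close>, and D\<psi> carries that velocity back. Conversely, the straight
  line through \<open>\<phi> x\<close> in direction \<open>l\<close> stays in \<open>L\<close>, and
  its image under \<psi> is a curve in \<open>M\<close> with velocity
  \<open>D\<psi>(\<phi> x) l\<close>.\<close>

lemma tangent_space_at_flattened:
  fixes M :: "'a::euclidean_space set"
  assumes "x \<in> M" "open U" "x \<in> U" "open V" "homeomorphism U V \<phi> \<psi>"
    and "smooth_on U \<phi>" "smooth_on V \<psi>" "subspace L" "\<phi> ` (M \<inter> U) = V \<inter> L"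
  shows "tangent_space_at M x = frechet_derivative \<psi> (at (\<phi> x)) ` L"
proof
  have inv: "\<psi> (\<phi> y) = y" if "y \<in> U" for y
    using assms(5) that by (simp add: homeomorphism_def)
  have \<phi>x: "\<phi> x \<in> V" "\<phi> x \<in> L"
    using assms(1,3,9) by blast+
  have D\<phi>: "(\<phi> has_derivative frechet_derivative \<phi> (at x)) (at x)"
    using smooth_on_has_derivative assms by blast
  have D\<psi>: "(\<psi> has_derivative frechet_derivative \<psi> (at (\<phi> x))) (at (\<phi> x))"
    using smooth_on_has_derivative assms \<phi>x by blast
  show "tangent_space_at M x \<subseteq> frechet_derivative \<psi> (at (\<phi> x)) ` L"
  proof
    fix v assume "v \<in> tangent_space_at M x"
    then obtain \<epsilon> c where \<epsilon>: "\<epsilon> > (0::real)" and cM: "c ` {-\<epsilon><..<\<epsilon>} \<subseteq> M"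
      and c0: "c 0 = x" and c': "(c has_vector_derivative v) (at 0)"
      unfolding tangent_space_at_def by blast
    have "isCont c 0"
      using c' has_vector_derivative_continuous by blast
    then have "\<forall>\<^sub>F t in at 0. c t \<in> U"
      using assms(2,3) c0 by (auto simp: isCont_def intro: topological_tendstoD)
    \<comment> \<open>The point \<open>t = 0\<close> is included because replacing
      \<open>\<psi> \<circ> (\<phi> \<circ> c)\<close> by \<open>c\<close> under the derivative also
      needs equality there.\<close>
    then have "\<forall>\<^sub>F t in nhds 0. c t \<in> U"
      using assms(3) c0 by (simp add: eventually_nhds_conv_at)
    moreover have "\<forall>\<^sub>F t in nhds 0. t \<in> {-\<epsilon><..<\<epsilon>}"
      using \<epsilon> by (intro eventually_nhds_in_open) auto
    ultimately have ev: "\<forall>\<^sub>F t in nhds 0. c t \<in> M \<inter> U"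
      by eventually_elim (use cM in auto)
    let ?w = "frechet_derivative \<phi> (at x) v"
    have w: "((\<phi> \<circ> c) has_vector_derivative ?w) (at 0)"
      using vector_derivative_diff_chain_within[OF c', of \<phi>] D\<phi> c0
      by (simp add: has_derivative_at_withinI)
    have "\<forall>\<^sub>F t in nhds 0. (\<phi> \<circ> c) t \<in> L"
      using ev by eventually_elim (use assms(9) in auto)
    then have "?w \<in> L"
      using has_vector_derivative_in_closed_subspace[OF assms(8) w] c0 \<phi>x(2)
      by (simp add: eventually_nhds_conv_at)
    have "((\<psi> \<circ> (\<phi> \<circ> c)) has_vector_derivative frechet_derivative \<psi> (at (\<phi> x)) ?w) (at 0)"
      using vector_derivative_diff_chain_within[OF w, of \<psi>] D\<psi> c0
      by (simp add: has_derivative_at_withinI)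
    moreover have "\<forall>\<^sub>F t in nhds 0. (\<psi> \<circ> (\<phi> \<circ> c)) t = c t"
      using ev by eventually_elim (simp add: inv)
    ultimately have "(c has_vector_derivative frechet_derivative \<psi> (at (\<phi> x)) ?w) (at 0)"
      using has_vector_derivative_cong_ev[of UNIV "\<psi> \<circ> (\<phi> \<circ> c)" c 0] eventually_nhds_x_imp_x[of _ 0]
      by auto
    then have "v = frechet_derivative \<psi> (at (\<phi> x)) ?w"
      using c' vector_derivative_unique_at by blast
    then show "v \<in> frechet_derivative \<psi> (at (\<phi> x)) ` L"
      using \<open>?w \<in> L\<close> by blast
  qed
  show "frechet_derivative \<psi> (at (\<phi> x)) ` L \<subseteq> tangent_space_at M x"
  proof
    fix v assume "v \<in> frechet_derivative \<psi> (at (\<phi> x)) ` L"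
    then obtain l where l: "l \<in> L" and v: "v = frechet_derivative \<psi> (at (\<phi> x)) l"
      by blast
    define A where "A = (\<lambda>t::real. \<phi> x + t *\<^sub>R l)"
    have "open (A -` V)"
      unfolding A_def by (intro open_vimage assms(4) continuous_intros)
    moreover have "0 \<in> A -` V"
      using \<phi>x by (simp add: A_def)
    ultimately obtain \<epsilon> where \<epsilon>: "\<epsilon> > 0" "ball 0 \<epsilon> \<subseteq> A -` V"
      using openE by blast
    then have AV: "A t \<in> V" if "t \<in> {-\<epsilon><..<\<epsilon>}" for t
      using that by (auto simp: subset_iff dist_real_def)
    have AL: "A t \<in> L" for t
      using \<phi>x l assms(8) by (simp add: A_def subspace_add subspace_scale)
    have "smooth_on {-\<epsilon><..<\<epsilon>} (\<lambda>t. \<psi> (\<phi> x + t *\<^sub>R l))"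
      using assms(7) AV unfolding smooth_on_def A_def
      by (intro allI Ck_on_compose_affine[where V = V] bounded_linear_scaleR_left) auto
    moreover have "\<psi> (A t) \<in> M" if t: "t \<in> {-\<epsilon><..<\<epsilon>}" for t
    proof -
      obtain y where "y \<in> M \<inter> U" "A t = \<phi> y"
        using AV[OF t] AL[of t] assms(9) by blast
      then show ?thesis
        by (simp add: inv)
    qed
    moreover have "((\<psi> \<circ> A) has_vector_derivative v) (at 0)"
    proof -
      have "(A has_vector_derivative l) (at 0)"
        unfolding A_def by (auto intro!: derivative_eq_intros)
      then show ?thesis
        using vector_derivative_diff_chain_within[of A l 0 UNIV \<psi>] D\<psi> v
        by (simp add: A_def has_derivative_at_withinI)
    qed
    ultimately show "v \<in> tangent_space_at M x"
      using \<epsilon>(1) assms(3)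
      unfolding tangent_space_at_def A_def o_def
      by (auto intro!: exI[of _ \<epsilon>] exI[of _ "\<lambda>t. \<psi> (\<phi> x + t *\<^sub>R l)"] simp: inv)
  qed
qed

lemma subspace_tangent_space_at:
  fixes M :: "'a::euclidean_space set"
  assumes "embedded_submanifold M" "x \<in> M"
  shows "subspace (tangent_space_at M x)"
proof -
  obtain U V \<phi> \<psi> and L :: "'a set" where *: "open U" "x \<in> U" "open V"
    "homeomorphism U V \<phi> \<psi>" "smooth_on U \<phi>" "smooth_on V \<psi>" "subspace L"
    "\<phi> ` (M \<inter> U) = V \<inter> L"
    using assms unfolding embedded_submanifold_def by metis
  then have "\<phi> x \<in> V"
    using assms(2) by blast
  then have "linear (frechet_derivative \<psi> (at (\<phi> x)))"
    using smooth_on_has_derivative[OF *(6)] has_derivative_linear by blast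
  then show ?thesis
    using tangent_space_at_flattened[OF assms(2) *] *(7) by (simp add: linear_subspace_image)
qed

section \<open>Orthogonal projections\<close>

lemma orth_proj_unique:
  assumes "subspace W" "y \<in> W" "x - y \<in> orthogonal_comp W"
  shows "orth_proj W x = y"
  unfolding orth_proj_def
proof (rule the_equality)
  fix z assume z: "z \<in> W \<and> x - z \<in> orthogonal_comp W"
  \<comment> \<open>This difference is \<open>z - y\<close>, which also lies in \<open>W\<close> and
    is thus orthogonal to itself.\<close>
  have "(x - y) - (x - z) \<in> orthogonal_comp W"
    using z assms subspace_orthogonal_comp subspace_diff by blast
  moreover have "z - y \<in> W"
    using z assms subspace_diff by blast
  ultimately show "z = y"
    by (auto simp: orthogonal_comp_def orthogonal_def dest: bspec[of _ _ "z - y"])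
qed (use assms in blast)

lemma orth_proj:
  assumes "subspace W"
  shows "orth_proj W x \<in> W" "x - orth_proj W x \<in> orthogonal_comp W"
proof -
  obtain y z where yz: "y \<in> span W" "\<And>w. w \<in> span W \<Longrightarrow> orthogonal z w" "x = y + z"
    using orthogonal_subspace_decomp_exists by blast
  then have "y \<in> W" "x - y \<in> orthogonal_comp W"
    using assms by (auto simp: orthogonal_comp_def orthogonal_commute span_eq_iff[THEN iffD2])
  then show "orth_proj W x \<in> W" "x - orth_proj W x \<in> orthogonal_comp W"
    using orth_proj_unique[OF assms] by simp_all
qed

text \<open>By uniqueness it suffices that the remainder \<open>orth_proj W x\<close> lies in the
  double complement, which contains \<open>W\<close>.\<close>

lemma orth_proj_orthogonal_comp:
  assumes "subspace W"
  shows "orth_proj (orthogonal_comp W) x = x - orth_proj W x"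
  using orth_proj[OF assms, of x] orthogonal_comp_subset[of W]
  by (intro orth_proj_unique subspace_orthogonal_comp) auto

section \<open>The cubic equation and the quartic model\<close>

lemma cubic_unique_pos_root:
  fixes a b :: real
  assumes "a \<ge> 0" "b \<ge> 1"
  shows "\<exists>\<theta>. \<forall>\<tau>. \<tau> > 0 \<and> a * \<tau> ^ 3 + b * \<tau> - 1 = 0 \<longleftrightarrow> \<tau> = \<theta>"
proof -
  define p where "p = (\<lambda>\<tau>::real. a * \<tau> ^ 3 + b * \<tau> - 1)"
  \<comment> \<open>\<open>p 0 = -1\<close> and \<open>p 1 = a + b - 1 \<ge> 0\<close>.\<close>
  have "\<exists>\<theta>\<ge>0. \<theta> \<le> 1 \<and> p \<theta> = 0"
    using assms unfolding p_def by (intro IVT') (auto intro!: continuous_intros)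
  then obtain \<theta> where \<theta>: "\<theta> \<ge> 0" "p \<theta> = 0"
    by blast
  then have "\<theta> > 0"
    by (cases "\<theta> = 0") (auto simp: p_def)
  have mono: "p s < p t" if "0 < s" "s < t" for s t
  proof -
    have "a * s ^ 3 \<le> a * t ^ 3"
      using that assms by (intro mult_left_mono power_mono) auto
    moreover have "b * s < b * t"
      using that assms by simp
    ultimately show ?thesis
      by (simp add: p_def)
  qed
  have "\<tau> = \<theta>" if "\<tau> > 0" "p \<tau> = 0" for \<tau>
    using mono[of \<tau> \<theta>] mono[of \<theta> \<tau>] that \<theta>(2) \<open>\<theta> > 0\<close> by (cases \<tau> \<theta> rule: linorder_cases) auto
  then show ?thesis
    using \<open>\<theta> > 0\<close> \<theta>(2) unfolding p_def by metis
qed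

text \<open>With \<open>K = N + (norm u0)\<^sup>2 + 1\<close> the cubic says
  \<open>K * \<theta> = 1\<close>, that is \<open>p = - K *\<^sub>R u0\<close>: stationarity of the
  model at \<open>u0\<close>. Substituting this for \<open>p\<close> and completing squares gives
  the identity, which serves in place of a convexity argument.\<close>

lemma quartic_model_excess:
  fixes p u u0 :: "'a::real_inner" and N \<theta> :: real
  assumes u0: "u0 = - \<theta> *\<^sub>R p" and \<theta>: "(norm p)\<^sup>2 * \<theta> ^ 3 + (N + 1) * \<theta> - 1 = 0"
  shows "(p \<bullet> u + 1/4 * (N + (norm u)\<^sup>2)\<^sup>2 + 1/2 * (N + (norm u)\<^sup>2))
       - (p \<bullet> u0 + 1/4 * (N + (norm u0)\<^sup>2)\<^sup>2 + 1/2 * (N + (norm u0)\<^sup>2))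
       = 1/2 * (N + (norm u0)\<^sup>2 + 1) * (norm (u - u0))\<^sup>2
         + 1/4 * ((norm u)\<^sup>2 - (norm u0)\<^sup>2)\<^sup>2"
proof -
  define K where "K = N + (norm u0)\<^sup>2 + 1"
  have "(norm u0)\<^sup>2 = \<theta>\<^sup>2 * (norm p)\<^sup>2"
    by (simp add: u0 power_mult_distrib)
  then have "K * \<theta> = 1"
    using \<theta> by (simp add: K_def algebra_simps power2_eq_square power3_eq_cube)
  then have p: "p = - K *\<^sub>R u0"
    by (simp add: u0)
  have inner: "p \<bullet> z = - K * (u0 \<bullet> z)" for z
    by (subst p) simp
  have norm: "(norm (u - u0))\<^sup>2 = (norm u)\<^sup>2 - 2 * (u0 \<bullet> u) + (norm u0)\<^sup>2"
    by (simp add: power2_norm_eq_inner inner_diff inner_commute)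
  show ?thesis
    unfolding inner norm K_def by (simp add: dot_square_norm power2_eq_square field_simps)
qed

section \<open>Reduction to the quartic model and minimisation\<close>

theorem proposition3p1:
  fixes M :: "(real ^ 'n) set"
    and f :: "real ^ 'n \<Rightarrow> real"
    and x c :: "real ^ 'n"
    and \<gamma> :: real
  assumes "embedded_submanifold M"
    and "continuously_differentiable f"
    and "x \<in> M"
    and "\<gamma> > 0"
    and "c = gradient f x /\<^sub>R \<gamma> - gradient quartic_kernel x"
  shows "\<exists>\<theta>::real.
           (\<forall>\<tau>::real.
              \<tau> > 0 \<and>
              (norm (orth_proj (tangent_space_at M x) c))\<^sup>2 * \<tau> ^ 3
                + ((norm (orth_proj (normal_space_at M x) x))\<^sup>2 + 1) * \<tau> - 1 = 0
              \<longleftrightarrow> \<tau> = \<theta>) \<and>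
           (\<forall>v. is_arg_min
                  (\<lambda>w. gradient f x \<bullet> w + \<gamma> * bregman quartic_kernel (x + w) x)
                  (\<lambda>w. w \<in> tangent_space_at M x) v
              \<longleftrightarrow>
              v = - \<theta> *\<^sub>R orth_proj (tangent_space_at M x) c - orth_proj (tangent_space_at M x) x)"
proof -
  let ?T = "tangent_space_at M x"
  have T: "subspace ?T"
    using subspace_tangent_space_at assms by blast
  define p where "p = orth_proj ?T c"
  define y where "y = orth_proj ?T x"
  define N where "N = (norm (x - y))\<^sup>2"
  define G where "G u = p \<bullet> u + 1/4 * (N + (norm u)\<^sup>2)\<^sup>2 + 1/2 * (N + (norm u)\<^sup>2)" for u
  let ?F = "\<lambda>w. gradient f x \<bullet> w + \<gamma> * bregman quartic_kernel (x + w) x"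
  have normal: "orth_proj (normal_space_at M x) x = x - y"
    unfolding normal_space_at_def y_def using orth_proj_orthogonal_comp[OF T] .
  have pT: "p \<in> ?T" and yT: "y \<in> ?T"
    unfolding p_def y_def using orth_proj[OF T] by auto
  have cp: "(c - p) \<bullet> w = 0" and xy: "(x - y) \<bullet> w = 0" if "w \<in> ?T" for w
    using that orth_proj(2)[OF T, of c] orth_proj(2)[OF T, of x]
    by (auto simp: p_def y_def orthogonal_comp_def orthogonal_def inner_commute)
  \<comment> \<open>For tangent \<open>w\<close>, the vector \<open>y + w\<close> is the tangential
    part of \<open>x + w\<close>; the subtracted term does not depend on \<open>w\<close>.\<close>
  have F: "?F w = \<gamma> * G (y + w) - \<gamma> * (p \<bullet> y + quartic_kernel x)" if w: "w \<in> ?T" for w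
  proof -
    \<comment> \<open>Solving the definition of \<open>c\<close> for the gradient of
      \<open>f\<close> makes the linear term of the Bregman distance cancel, leaving
      \<open>\<gamma> * (c \<bullet> w)\<close>.\<close>
    have "gradient f x = \<gamma> *\<^sub>R (c + gradient quartic_kernel x)"
      using assms(4,5) by simp
    then have "?F w = \<gamma> * (c \<bullet> w + quartic_kernel (x + w) - quartic_kernel x)"
      by (simp add: bregman_def inner_simps algebra_simps)
    moreover have "c \<bullet> w = p \<bullet> (y + w) - p \<bullet> y"
      using cp[OF w] by (simp add: inner_simps)
    moreover have "(norm (x + w))\<^sup>2 = N + (norm (y + w))\<^sup>2"
    proof -
      have "(x - y) \<bullet> (y + w) = 0"
        using xy yT w T subspace_add by blast
      then have "(norm ((x - y) + (y + w)))\<^sup>2 = N + (norm (y + w))\<^sup>2"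
        unfolding N_def by (intro norm_add_Pythagorean) (simp add: orthogonal_def)
      then show ?thesis
        by simp
    qed
    then have "quartic_kernel (x + w)
        = 1/4 * (N + (norm (y + w))\<^sup>2)\<^sup>2 + 1/2 * (N + (norm (y + w))\<^sup>2)"
      unfolding quartic_kernel_def by (metis power_mult mult_2 numeral_Bit0)
    ultimately show ?thesis
      unfolding G_def by (simp add: algebra_simps)
  qed
  \<comment> \<open>Since \<open>N\<close> is a squared norm, the linear coefficient is at least
    1.\<close>
  obtain \<theta> where \<theta>: "\<And>\<tau>. \<tau> > 0 \<and> (norm p)\<^sup>2 * \<tau> ^ 3 + (N + 1) * \<tau> - 1 = 0 \<longleftrightarrow> \<tau> = \<theta>"
    using cubic_unique_pos_root[of "(norm p)\<^sup>2" "N + 1"] by (auto simp: N_def)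
  define u0 where "u0 = - \<theta> *\<^sub>R p"
  have u0T: "u0 - y \<in> ?T"
    unfolding u0_def using pT yT T by (intro subspace_diff subspace_scale)
  \<comment> \<open>The candidate is \<open>u0 - y\<close> because \<open>u = y + w\<close>.
    Strictness gives both minimality and uniqueness: the first excess term is positive for
    \<open>y + w \<noteq> u0\<close>.\<close>
  have less: "?F (u0 - y) < ?F w" if w: "w \<in> ?T" "w \<noteq> u0 - y" for w
  proof -
    have "G (y + w) - G u0 = 1/2 * (N + (norm u0)\<^sup>2 + 1) * (norm (y + w - u0))\<^sup>2
         + 1/4 * ((norm (y + w))\<^sup>2 - (norm u0)\<^sup>2)\<^sup>2"
      unfolding G_def using \<theta> by (intro quartic_model_excess[OF u0_def]) blast
    moreover have "norm (y + w - u0) > 0"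
      using w(2) by (auto simp: algebra_simps)
    moreover have "N + (norm u0)\<^sup>2 + 1 > 0"
      unfolding N_def by (simp add: add_nonneg_pos)
    ultimately have "G u0 < G (y + w)"
      by (smt (verit) mult_pos_pos zero_less_power zero_le_power2 zero_less_divide_1_iff mult_nonneg_nonneg)
    then show ?thesis
      unfolding F[OF w(1)] F[OF u0T] using assms(4) by simp
  qed
  have "is_arg_min ?F (\<lambda>w. w \<in> ?T) v \<longleftrightarrow> v = u0 - y" for v
    unfolding is_arg_min_def using less u0T by (metis less_asym less_irrefl)
  then show ?thesis
    using \<theta> unfolding normal p_def[symmetric] y_def[symmetric] N_def[symmetric] u0_def
    by (intro exI[of _ \<theta>]) blast
qed

end
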